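(* Let $m\ge 2$ be an integer with $\omega(m)=1$. Then $m=n$, $m=2n$ or $m=4n$ for some odd positive integer $n$ all of whose positive divisors $d$ satisfy $\omega(d)=1$.
   Context: $F_n$ denotes the Fibonacci sequence: $F_0=0$, $F_1=1$, $F_n=F_{n-1}+F_{n-2}$. For an integer $m\ge 2$, the Pisano period $\pi(m)$ is the least positive period of $(F_n \bmod m)$, and $\omega(m)$ is the number of indices $0\le n<\pi(m)$ with $m\mid F_n$. By convention $\omega(1)=1$. *)

theory Defs
  imports "HOL-Number_Theory.Fib"
begin

definition pisano :: "nat \<Rightarrow> nat" where
  "pisano m = (LEAST p. 0 < p \<and> (\<forall>n. fib (n + p) mod m = fib n mod m))"

definition omega :: "nat \<Rightarrow> nat" where
  "omega m = card {n. n < pisano m \<and> m dvd fib n}"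

text \<open>For \<open>m = 1\<close> the general definition already yields the conventional value.\<close>

lemma omega_1: "omega 1 = 1"
proof -
  have "pisano 1 = 1"
    unfolding pisano_def by (rule Least_equality) auto
  then show ?thesis
    by (simp add: omega_def)
qed

end

theory Submission imports Defs begin

text \<open>Let \<open>L\<^sub>k = 2 F\<^sub>k\<^sub>+\<^sub>1 - F\<^sub>k\<close> be the Lucas numbers. For \<open>m \<ge> 3\<close>, Cassini's identity makes the
  Pisano period even, say \<open>2k\<close>. If \<open>k\<close> is even, then \<open>F\<^sub>2\<^sub>k = F\<^sub>k L\<^sub>k\<close> and
  \<open>F\<^sub>2\<^sub>k\<^sub>+\<^sub>1 - 1 = F\<^sub>k L\<^sub>k\<^sub>+\<^sub>1\<close> force \<open>m\<close> to divide \<open>F\<^sub>k\<close>, so \<open>\<omega>(m) > 1\<close>. If \<open>k\<close> is odd, then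
  \<open>F\<^sub>2\<^sub>k\<^sub>+\<^sub>1 - 1 = F\<^sub>k\<^sub>+\<^sub>1 L\<^sub>k\<close> and \<open>m\<close> divides \<open>L\<^sub>k\<close>. Thus \<open>\<omega>(m) = 1\<close> makes \<open>m\<close> a divisor of some \<open>L\<^sub>k\<close>
  with \<open>k\<close> odd. Divisibility of \<open>L\<^sub>k\<close> passes to the divisors of \<open>m\<close>, and for odd divisors it
  implies \<open>\<omega> = 1\<close> in return; moreover no Lucas number is divisible by \<open>8\<close>.\<close>

text \<open>Here 0 counts as a period, which lets \<open>pisano_dvd\<close> speak of the remainder
  of a period.\<close>

definition fib_period :: "nat \<Rightarrow> nat \<Rightarrow> bool" where
  "fib_period m p \<longleftrightarrow> (\<forall>n. fib (n + p) mod m = fib n mod m)"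

definition lucas :: "nat \<Rightarrow> int" where
  "lucas k = 2 * int (fib (k + 1)) - int (fib k)"

section \<open>Fibonacci-Lucas identities and divisibility of Lucas numbers\<close>

lemma cassini: "(int (fib (k + 1)))\<^sup>2 - int (fib k) * int (fib (k + 1)) - (int (fib k))\<^sup>2 = (-1) ^ k"
  using fib_Cassini_int[of k] by (simp add: algebra_simps power2_eq_square)

lemma int_fib_double: "int (fib (2 * k)) = int (fib k) * lucas k"
proof (cases k)
  case (Suc j)
  have "fib (2 * k) = fib (Suc (k + j))"
    by (simp add: Suc mult_2)
  also have "\<dots> = fib k * (fib (Suc k) + fib j)"
    by (subst fib_add) (simp add: Suc algebra_simps)
  finally show ?thesis
    by (simp add: lucas_def Suc)
qed (simp add: lucas_def)

lemma fib_Suc_double: "fib (2 * k + 1) = (fib k)\<^sup>2 + (fib (k + 1))\<^sup>2"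
  using fib_add[of k k] by (simp add: mult_2 power2_eq_square)

text \<open>Cassini rewrites the 1 as a quadratic form in F_k and F_(k+1), with a sign given by the
  parity of k. Here F_(k+1)^2 cancels; for odd k it is F_k^2 that does.\<close>

lemma fib_Suc_double_even:
  assumes "even k"
  shows "int (fib (2 * k + 1)) - 1 = int (fib k) * lucas (k + 1)"
  using cassini[of k] assms unfolding fib_Suc_double lucas_def
  by (simp add: algebra_simps power2_eq_square)

lemma fib_Suc_double_odd:
  assumes "odd k"
  shows "int (fib (2 * k + 1)) - 1 = int (fib (k + 1)) * lucas k"
  using cassini[of k] assms unfolding fib_Suc_double lucas_def
  by (simp add: algebra_simps power2_eq_square)

lemma lucas_Suc_Suc: "lucas (Suc (Suc k)) = lucas (Suc k) + lucas k"
  by (simp add: lucas_def)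

lemma coprime_lucas_Suc: "coprime (lucas k) (lucas (Suc k))"
proof (induction k)
  case 0
  show ?case by (simp add: lucas_def)
next
  case (Suc k)
  then have "gcd (lucas (Suc k)) (lucas (Suc k) + lucas k) = 1"
    by (simp add: gcd.commute)
  then show ?case
    by (simp add: lucas_Suc_Suc coprime_iff_gcd_eq_1)
qed

lemma not_8_dvd_lucas: "\<not> 8 dvd lucas k"
proof -
  \<comment> \<open>The orbit of (L_0, L_1) = (2, 1) under (a, b) -> (b, a + b) mod 8: a cycle of
    length 12 with no 0 in it.\<close>
  define S :: "(int \<times> int) set" where
    "S = {(2,1), (1,3), (3,4), (4,7), (7,3), (3,2), (2,5), (5,7), (7,4), (4,3), (3,7), (7,2)}"
  have step: "(b, (b + a) mod 8) \<in> S" if "(a, b) \<in> S" for a b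
    using that unfolding S_def by (elim insertE) simp_all
  have "(lucas k mod 8, lucas (Suc k) mod 8) \<in> S"
  proof (induction k)
    case 0
    show ?case by (simp add: lucas_def S_def)
  next
    case (Suc k)
    from step[OF this] show ?case
      by (simp add: lucas_Suc_Suc mod_add_eq)
  qed
  moreover have "a \<noteq> 0" if "(a, b) \<in> S" for a b
    using that unfolding S_def by (elim insertE) simp_all
  ultimately show ?thesis
    by (metis dvd_imp_mod_0)
qed

text \<open>F_k + L_k = 2 F_(k+1), and F_(k+1) is coprime to F_k.\<close>

lemma gcd_fib_lucas_dvd_2:
  assumes "int d dvd int (fib k)" "int d dvd lucas k"
  shows "d dvd 2"
proof -
  have "int d dvd 2 * int (fib (k + 1))"
    using dvd_add[OF assms] by (simp add: lucas_def)
  then have "d dvd 2 * fib (k + 1)"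
    by (metis of_nat_dvd_iff of_nat_mult of_nat_numeral)
  moreover have "coprime d (fib (k + 1))"
    using assms(1) coprime_fib_Suc_nat[of k] by (metis Suc_eq_plus1 coprime_divisors dvd_refl of_nat_dvd_iff)
  ultimately show ?thesis
    by (simp add: coprime_dvd_mult_left_iff)
qed

section \<open>Periods modulo m and the zeros within one period\<close>

lemma mod_eq_iff_int_dvd: "a mod m = b mod m \<longleftrightarrow> int m dvd int a - int b"
  by (metis mod_eq_dvd_iff of_nat_eq_iff zmod_int)

lemma fib_period_iff:
  "fib_period m p \<longleftrightarrow> int m dvd int (fib p) \<and> int m dvd int (fib (p + 1)) - 1"
proof
  assume P: "fib_period m p"
  then have "int m dvd int (fib (0 + p)) - int (fib 0)" "int m dvd int (fib (1 + p)) - int (fib 1)"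
    unfolding fib_period_def mod_eq_iff_int_dvd by blast+
  then show "int m dvd int (fib p) \<and> int m dvd int (fib (p + 1)) - 1"
    by simp
next
  assume A: "int m dvd int (fib p) \<and> int m dvd int (fib (p + 1)) - 1"
  have "int m dvd int (fib (n + p)) - int (fib n)" for n
  proof (induction n rule: fib.induct)
    case (3 n)
    from dvd_add[OF this] show ?case by (simp add: algebra_simps)
  qed (use A in auto)
  then show "fib_period m p"
    unfolding fib_period_def mod_eq_iff_int_dvd by blast
qed

lemma fib_period_exists:
  assumes "0 < m"
  shows "\<exists>p>0. fib_period m p"
proof -
  let ?s = "\<lambda>n. (fib n mod m, fib (Suc n) mod m)"
  have "finite (range ?s)"
    by (rule finite_subset[of _ "{..<m} \<times> {..<m}"]) (use assms in auto)
  \<comment> \<open>Pigeonhole on the residues of consecutive pairs.\<close>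
  then have "\<not> inj ?s"
    using finite_imageD infinite_UNIV_nat by blast
  then obtain i p where "p > 0" "?s (i + p) = ?s i"
    unfolding inj_def by (metis (no_types, lifting) less_imp_add_positive linorder_neqE_nat)
  \<comment> \<open>The recurrence also runs backwards, so the repetition descends to index
    0.\<close>
  from this(2) have "?s p = ?s 0"
  proof (induction i)
    case (Suc i)
    then have "int m dvd int (fib (Suc (Suc i) + p)) - int (fib (Suc (Suc i)))"
      and "int m dvd int (fib (Suc i + p)) - int (fib (Suc i))"
      by (simp_all del: fib.simps(3) flip: mod_eq_iff_int_dvd)
    from dvd_diff[OF this] have "int m dvd int (fib (i + p)) - int (fib i)"
      by (simp add: algebra_simps)
    with Suc show ?case by (simp add: mod_eq_iff_int_dvd)
  qed simp
  then have "int m dvd int (fib p) - int (fib 0)" "int m dvd int (fib (Suc p)) - int (fib (Suc 0))"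
    by (simp_all only: prod.inject flip: mod_eq_iff_int_dvd)
  then have "fib_period m p"
    unfolding fib_period_iff by simp
  with \<open>p > 0\<close> show ?thesis by blast
qed

lemma fib_period_pisano:
  assumes "0 < m"
  shows "0 < pisano m" "fib_period m (pisano m)"
proof -
  have "0 < pisano m \<and> fib_period m (pisano m)"
    using LeastI_ex[OF fib_period_exists[OF assms]]
    by (simp add: pisano_def fib_period_def)
  then show "0 < pisano m" "fib_period m (pisano m)" by auto
qed

lemma pisano_le: "0 < p \<Longrightarrow> fib_period m p \<Longrightarrow> pisano m \<le> p"
  unfolding pisano_def fib_period_def by (rule Least_le) auto

lemma pisano_dvd:
  assumes "0 < m" "fib_period m p"
  shows "pisano m dvd p"
proof -
  let ?q = "pisano m"
  have mult: "fib (n + j * ?q) mod m = fib n mod m" for n j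
  proof (induction j)
    case (Suc j)
    have "fib (n + Suc j * ?q) mod m = fib (n + j * ?q + ?q) mod m"
      by (simp add: algebra_simps)
    with Suc show ?case
      using fib_period_pisano(2)[OF assms(1)] by (simp add: fib_period_def)
  qed simp
  have "fib (n + p mod ?q) mod m = fib n mod m" for n
    using mult[of "n + p mod ?q" "p div ?q"] assms(2) by (simp add: fib_period_def add.assoc)
  then have "fib_period m (p mod ?q)"
    by (simp add: fib_period_def)
  then have "p mod ?q = 0"
    using pisano_le[of "p mod ?q" m] fib_period_pisano(1)[OF assms(1)]
    by (meson mod_less_divisor not_gr_zero not_le)
  then show ?thesis by (simp add: dvd_eq_mod_eq_0)
qed

lemma omega_eq_1_iff:
  assumes "0 < m"
  shows "omega m = 1 \<longleftrightarrow> (\<forall>n. 0 < n \<and> n < pisano m \<longrightarrow> \<not> m dvd fib n)"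
proof -
  let ?S = "{n. n < pisano m \<and> m dvd fib n}"
  have "0 \<in> ?S"
    using fib_period_pisano(1)[OF assms] by simp
  then have "omega m = 1 \<longleftrightarrow> ?S = {0}"
    unfolding omega_def One_nat_def card_1_singleton_iff by (metis singletonD)
  also have "\<dots> \<longleftrightarrow> ?S \<subseteq> {0}"
    using \<open>0 \<in> ?S\<close> by blast
  also have "\<dots> \<longleftrightarrow> (\<forall>n. 0 < n \<and> n < pisano m \<longrightarrow> \<not> m dvd fib n)"
    unfolding subset_iff mem_Collect_eq singleton_iff neq0_conv[symmetric] by blast
  finally show ?thesis .
qed

section \<open>Omega 1 and divisors of Lucas numbers of odd index\<close>

lemma dvd_lucas_if_omega_eq_1:
  assumes "3 \<le> m" "omega m = 1"
  obtains k where "odd k" "int m dvd lucas k"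
proof -
  let ?q = "pisano m"
  have m: "0 < m" using assms(1) by simp
  have q: "int m dvd int (fib ?q)" "int m dvd int (fib (?q + 1)) - 1"
    using fib_period_pisano(2)[OF m] by (simp_all add: fib_period_iff)
  have "even ?q"
  proof (rule ccontr)
    obtain a b where ab: "int (fib ?q) = int m * a" "int (fib (?q + 1)) = int m * b + 1"
      using q by (metis dvdE diff_add_cancel)
    assume "odd ?q"
    \<comment> \<open>Modulo m, Cassini at an odd period reads 1 = -1, impossible for m >=
      3.\<close>
    then have "(int m * b + 1)\<^sup>2 - int m * a * (int m * b + 1) - (int m * a)\<^sup>2 = -1"
      using cassini[of ?q] ab by simp
    then have "2 = int m * (a * (int m * b + 1) + int m * a * a - b * (int m * b + 2))"
      by (simp add: algebra_simps power2_eq_square)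
    then have "int m dvd 2" by (rule dvdI)
    then show False using zdvd_imp_le[of "int m" 2] assms(1) by simp
  qed
  then obtain k where k: "?q = 2 * k" by blast
  have "odd k"
  proof
    assume "even k"
    have "int m dvd int (fib k) * lucas k" "int m dvd int (fib k) * lucas (Suc k)"
      using q fib_Suc_double_even[OF \<open>even k\<close>] by (simp_all add: k int_fib_double)
    \<comment> \<open>Coprimality of L_k and L_(k+1) leaves F_k alone: a zero strictly inside the
      period.\<close>
    then have "int m dvd gcd (int (fib k) * lucas k) (int (fib k) * lucas (Suc k))"
      by simp
    also have "\<dots> = int (fib k)"
      using coprime_lucas_Suc[of k] by (simp add: gcd_mult_left coprime_iff_gcd_eq_1)
    finally have "m dvd fib k" by simp
    moreover have "0 < k" "k < ?q"
      using fib_period_pisano(1)[OF m] k by auto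
    ultimately show False
      using assms(2) omega_eq_1_iff[OF m] by blast
  qed
  have "int m dvd lucas k * int (fib k)" "int m dvd lucas k * int (fib (Suc k))"
    using q unfolding k int_fib_double fib_Suc_double_odd[OF \<open>odd k\<close>]
    by (simp_all add: mult.commute)
  then have "int m dvd gcd (lucas k * int (fib k)) (lucas k * int (fib (Suc k)))"
    by simp
  also have "\<dots> = \<bar>lucas k\<bar>"
    using coprime_fib_Suc_nat[of k] by (simp add: gcd_mult_left coprime_iff_gcd_eq_1)
  finally show ?thesis
    using that \<open>odd k\<close> by simp
qed

text \<open>Since d divides F_(2k), a zero at n yields one at g = gcd(n, 2k). If g is odd, it
  divides k, so d divides both F_k and L_k, hence 2. If g is even, 2g is a period too, and this
  forces the Pisano period to divide n.\<close>

lemma omega_eq_1_if_odd_dvd_lucas: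
  assumes "odd d" "odd k" "int d dvd lucas k"
  shows "omega d = 1"
proof (cases "d = 1")
  case True
  then show ?thesis by (simp add: omega_1[simplified])
next
  case False
  have "0 < d" using assms(1) by (rule odd_pos)
  have "\<not> d dvd 2"
  proof
    assume "d dvd 2"
    then have "d \<le> 2" by (simp add: dvd_imp_le)
    with \<open>0 < d\<close> False have "d = 2" by simp
    with assms(1) show False by simp
  qed
  have per: "fib_period d (2 * k)"
    unfolding fib_period_iff using assms fib_Suc_double_odd[OF assms(2)]
    by (simp add: int_fib_double)
  have "\<not> d dvd fib n" if n: "0 < n" "n < pisano d" for n
  proof
    assume "d dvd fib n"
    define g where "g = gcd n (2 * k)"
    have "d dvd fib (2 * k)"
      using per by (simp add: fib_period_iff)
    with \<open>d dvd fib n\<close> have dg: "d dvd fib g"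
      by (simp add: g_def fib_gcd)
    have "even g"
    proof (rule ccontr)
      assume "odd g"
      moreover have "g dvd 2 * k" by (simp add: g_def)
      ultimately have "g dvd k"
        by (simp add: coprime_dvd_mult_right_iff)
      then have "fib g dvd fib k"
        by (metis fib_gcd gcd_dvd2 gcd_nat.absorb1)
      then have "d dvd fib k" using dg by (rule dvd_trans[rotated])
      then show False
        using gcd_fib_lucas_dvd_2[of d k] assms(3) \<open>\<not> d dvd 2\<close> by simp
    qed
    have "fib_period d (2 * g)"
    proof -
      have "int d dvd int (fib g)" using dg by simp
      then show ?thesis
        unfolding fib_period_iff int_fib_double fib_Suc_double_even[OF \<open>even g\<close>] by simp
    qed
    with per have "pisano d dvd gcd (2 * g) (2 * k)"
      using pisano_dvd[OF \<open>0 < d\<close>] by simp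
    \<comment> \<open>As k is odd, gcd(g, k) is an odd divisor of the even g, so its double still
      divides g.\<close>
    also have "\<dots> = 2 * gcd g k" by (simp add: gcd_mult_left)
    also have "\<dots> dvd g"
    proof -
      have "odd (gcd g k)" using assms(2) by (meson dvd_trans gcd_dvd2)
      then have "coprime 2 (gcd g k)" by simp
      then show ?thesis using \<open>even g\<close> by (simp add: divides_mult)
    qed
    also have "g dvd n" by (simp add: g_def)
    finally show False using n by (auto dest: dvd_imp_le)
  qed
  then show ?thesis
    using omega_eq_1_iff[OF \<open>0 < d\<close>] by blast
qed

theorem theorem2p11:
  fixes m :: nat
  assumes "m \<ge> 2" and "omega m = 1"
  shows "\<exists>n::nat. odd n \<and> 0 < n \<and> (\<forall>d. d dvd n \<longrightarrow> omega d = 1) \<and>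
           (m = n \<or> m = 2 * n \<or> m = 4 * n)"
proof (cases "m = 2")
  case True
  then show ?thesis
    \<comment> \<open>The period of 2 is 3, which is odd, so m = 2 is settled directly with n =
      1.\<close>
    using omega_1 by (intro exI[of _ 1]) simp
next
  case False
  with assms(1) have "3 \<le> m" by simp
  then obtain k where k: "odd k" "int m dvd lucas k"
    using dvd_lucas_if_omega_eq_1 assms(2) by blast
  have "\<not> 8 dvd m"
  proof
    assume "8 dvd m"
    then have "int 8 dvd int m" by (simp only: of_nat_dvd_iff)
    then have "8 dvd lucas k" using k(2) by (simp add: dvd_trans)
    then show False using not_8_dvd_lucas by blast
  qed
  \<comment> \<open>Halving m stops after at most two steps, as 8 does not divide m.\<close>
  obtain n where n: "odd n" "m = n \<or> m = 2 * n \<or> m = 4 * n"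
  proof (rule ccontr)
    assume no_n: "\<not> thesis"
    with that have "even m" by blast
    then obtain a where a: "m = 2 * a" by (rule evenE)
    with that no_n have "even a" by blast
    then obtain b where b: "a = 2 * b" by (rule evenE)
    with a have m: "m = 4 * b" by simp
    with that no_n have "even b" by blast
    then obtain c where "b = 2 * c" by (rule evenE)
    with m have "m = 8 * c" by simp
    with \<open>\<not> 8 dvd m\<close> show False by simp
  qed
  have "omega d = 1" if "d dvd n" for d
  proof (rule omega_eq_1_if_odd_dvd_lucas)
    show "odd d" using that n(1) dvd_trans by blast
    show "odd k" by fact
    have "int d dvd int m" using that n(2) by auto
    then show "int d dvd lucas k" using k(2) by (rule dvd_trans)
  qed
  then show ?thesis
    using n odd_pos by blast
qed

end
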